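(* Let $n \geq 3$ be an integer, let $P_n$ be the path on $n$ vertices and $C_n$ the cycle on $n$ vertices. Then, for reversible peg solitaire: (1) If $n$ is divisible by neither $2$ nor $3$, then $P_n$ and $C_n$ are not solvable. (2) If $n$ is divisible by $3$, then $P_n$ is solvable but not freely solvable, and $C_n$ is freely solvable but not doubly freely solvable. (3) If $n$ is not divisible by $3$ but is divisible by $2$, then $P_n$ is solvable but not freely solvable, and $C_n$ is doubly freely solvable.
   Context: Reversible peg solitaire on a finite simple graph $G$: a configuration assigns to each vertex either a peg or a hole. If $xyz$ is a path in $G$ ($x$ adjacent to $y$, $y$ adjacent to $z$, $x,y,z$ distinct), a jump is allowed when $x$ and $y$ have pegs and $z$ has a hole: it removes the pegs from $x$ and $y$ and places a peg on $z$. An unjump is the reverse move: when $x$ and $y$ have holes and $z$ has a peg, it removes the peg from $z$ and places pegs on $x$ and $y$. $G$ is solvable if for some starting configuration with exactly one hole, some finite sequence of jumps and unjumps produces a configuration with exactly one peg. $G$ is freely solvable if this is possible from every starting configuration with exactly one hole. $G$ is doubly freely solvable if for every starting configuration with exactly one hole and every vertex $v$ of $G$, some finite sequence of jumps and unjumps produces the configuration with a single peg on $v$. *)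

theory Defs
  imports "Graph_Theory.Pair_Digraph"
begin

text \<open>
  Finite simple graphs are rendered by the locale \<^locale>\<open>pair_graph\<close>: a finite vertex set with
  a symmetric and irreflexive adjacency relation. A configuration on \<open>G\<close> is the set
  \<open>S \<subseteq> pverts G\<close> of vertices that carry a peg; the vertices in \<open>pverts G - S\<close> are holes.
\<close>

definition path3 :: "'a pair_pre_digraph \<Rightarrow> 'a \<Rightarrow> 'a \<Rightarrow> 'a \<Rightarrow> bool" where
  "path3 G x y z \<longleftrightarrow> distinct [x, y, z] \<and> x \<rightarrow>\<^bsub>G\<^esub> y \<and> y \<rightarrow>\<^bsub>G\<^esub> z"

definition peg_jump :: "'a pair_pre_digraph \<Rightarrow> 'a set \<Rightarrow> 'a set \<Rightarrow> bool" where
  "peg_jump G S T \<longleftrightarrow>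
    (\<exists>x y z. path3 G x y z \<and> x \<in> S \<and> y \<in> S \<and> z \<notin> S \<and> T = (S - {x, y}) \<union> {z})"

definition peg_unjump :: "'a pair_pre_digraph \<Rightarrow> 'a set \<Rightarrow> 'a set \<Rightarrow> bool" where
  "peg_unjump G S T \<longleftrightarrow>
    (\<exists>x y z. path3 G x y z \<and> x \<notin> S \<and> y \<notin> S \<and> z \<in> S \<and> T = (S - {z}) \<union> {x, y})"

definition peg_move :: "'a pair_pre_digraph \<Rightarrow> 'a set \<Rightarrow> 'a set \<Rightarrow> bool" where
  "peg_move G S T \<longleftrightarrow> peg_jump G S T \<or> peg_unjump G S T"

abbreviation peg_reaches :: "'a pair_pre_digraph \<Rightarrow> 'a set \<Rightarrow> 'a set \<Rightarrow> bool" where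
  "peg_reaches G \<equiv> (peg_move G)\<^sup>*\<^sup>*"

definition one_hole :: "'a pair_pre_digraph \<Rightarrow> 'a set \<Rightarrow> bool" where
  "one_hole G S \<longleftrightarrow> (\<exists>h \<in> pverts G. S = pverts G - {h})"

definition one_peg :: "'a pair_pre_digraph \<Rightarrow> 'a set \<Rightarrow> bool" where
  "one_peg G S \<longleftrightarrow> (\<exists>v \<in> pverts G. S = {v})"

definition solvable :: "'a pair_pre_digraph \<Rightarrow> bool" where
  "solvable G \<longleftrightarrow> (\<exists>S. one_hole G S \<and> (\<exists>T. one_peg G T \<and> peg_reaches G S T))"

definition freely_solvable :: "'a pair_pre_digraph \<Rightarrow> bool" where
  "freely_solvable G \<longleftrightarrow> (\<forall>S. one_hole G S \<longrightarrow> (\<exists>T. one_peg G T \<and> peg_reaches G S T))"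

definition doubly_freely_solvable :: "'a pair_pre_digraph \<Rightarrow> bool" where
  "doubly_freely_solvable G \<longleftrightarrow>
    (\<forall>S. one_hole G S \<longrightarrow> (\<forall>v \<in> pverts G. peg_reaches G S {v}))"

definition path_graph :: "nat \<Rightarrow> nat pair_pre_digraph" where
  "path_graph n =
    \<lparr> pverts = {..<n},
      parcs = {(i, j). i < n \<and> j < n \<and> (j = Suc i \<or> i = Suc j)} \<rparr>"

text \<open>The following is the simple cycle on \<open>n\<close> vertices only for \<open>n \<ge> 3\<close>.\<close>

definition cycle_graph :: "nat \<Rightarrow> nat pair_pre_digraph" where
  "cycle_graph n =
    \<lparr> pverts = {..<n},
      parcs = {(i, j). i < n \<and> j < n \<and> (j = Suc i mod n \<or> i = Suc j mod n)} \<rparr>"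

lemma pair_graph_path_graph: "pair_graph (path_graph n)"
proof -
  have "finite (parcs (path_graph n))"
    by (rule finite_subset[of _ "{..<n} \<times> {..<n}"]) (auto simp: path_graph_def)
  then show ?thesis
    by unfold_locales (auto simp: path_graph_def symmetric_def sym_def)
qed

lemma pair_graph_cycle_graph:
  assumes "n \<ge> 3"
  shows "pair_graph (cycle_graph n)"
proof -
  have "finite (parcs (cycle_graph n))"
    by (rule finite_subset[of _ "{..<n} \<times> {..<n}"]) (auto simp: cycle_graph_def)
  moreover have "Suc i mod n \<noteq> i \<and> i \<noteq> Suc i mod n" if "i < n" for i
    using that assms by (cases "Suc i = n") auto
  ultimately show ?thesis
    by unfold_locales (auto simp: cycle_graph_def symmetric_def sym_def)
qed

lemma peg_unjump_iff_jump: "peg_unjump G S T \<longleftrightarrow> peg_jump G T S"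
proof
  assume "peg_unjump G S T"
  then obtain x y z where h: "path3 G x y z" "x \<notin> S" "y \<notin> S" "z \<in> S" "T = (S - {z}) \<union> {x, y}"
    unfolding peg_unjump_def by blast
  then have "x \<in> T" "y \<in> T" "z \<notin> T" "S = (T - {x, y}) \<union> {z}"
    by (auto simp: path3_def)
  with h(1) show "peg_jump G T S"
    unfolding peg_jump_def by blast
next
  assume "peg_jump G T S"
  then obtain x y z where h: "path3 G x y z" "x \<in> T" "y \<in> T" "z \<notin> T" "S = (T - {x, y}) \<union> {z}"
    unfolding peg_jump_def by blast
  then have "x \<notin> S" "y \<notin> S" "z \<in> S" "T = (S - {z}) \<union> {x, y}"
    by (auto simp: path3_def)
  with h(1) show "peg_unjump G S T"
    unfolding peg_unjump_def by blast
qed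

lemma peg_move_subset_pverts:
  assumes "pair_graph G" "S \<subseteq> pverts G" "peg_move G S T"
  shows "T \<subseteq> pverts G"
proof -
  interpret pair_graph G by fact
  show ?thesis
    using assms(2,3) unfolding peg_move_def peg_jump_def peg_unjump_def path3_def
    by (auto dest: in_arcsD1 in_arcsD2)
qed

end

theory Submission
  imports Defs "HOL-Analysis.Determinants" "HOL-Number_Theory.Cong"
begin

text \<open>
  A move, in either direction, complements the state of three consecutive vertices, and such a
  complementation is legal exactly when the two outer states differ. Reading a configuration as a
  word and replacing pegs and holes by suitable elements of orders \<open>6\<close> and \<open>3\<close> of
  \<open>SL\<^sub>2(\<int>/3)\<close> turns this into an identity between products of three matrices. So the product
  along the word is invariant on paths, and its trace is invariant on cycles; since the powers of
  the two matrices are periodic, a hole (or peg) only matters modulo \<open>6\<close>, and finitely many matrix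
  inequalities give the negative results, except that on \<open>C\<^sub>n\<close> with \<open>3 dvd n\<close> single pegs are
  separated by a parity of residues modulo \<open>3\<close>. Conversely, with \<open>1\<close> for a peg and
  \<open>0\<close> for a hole, \<open>1\<^sup>6\<close> can be rewritten to \<open>0\<^sup>6\<close> next to
  \<open>01\<close> or \<open>10\<close>, which reduces the solutions on paths to lengths \<open>2, 3, 4, 6\<close>. Rotating them solves
  the cycles from every hole, and \<open>1000\<close> reaching \<open>0001\<close> moves a single peg by three vertices.
\<close>

section \<open>Moves as flips\<close>

text \<open>Jumps and unjumps merge into one symmetric condition on a path of three vertices; the
  invariants below are checked only against this form.\<close>

lemma peg_moveE:
  assumes "peg_move G S T"
  obtains x y z where "path3 G x y z" "x \<in> S \<longleftrightarrow> z \<notin> S" "sym_diff S T = {x, y, z}"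
proof -
  obtain x y z where p: "path3 G x y z"
    and m: "x \<in> S \<and> y \<in> S \<and> z \<notin> S \<and> T = (S - {x, y}) \<union> {z} \<or>
            x \<notin> S \<and> y \<notin> S \<and> z \<in> S \<and> T = (S - {z}) \<union> {x, y}"
    using assms unfolding peg_move_def peg_jump_def peg_unjump_def by blast
  have "distinct [x, y, z]"
    using p by (simp add: path3_def)
  then have "(x \<in> S \<longleftrightarrow> z \<notin> S) \<and> sym_diff S T = {x, y, z}"
    using m by auto
  with p that show thesis by blast
qed

text \<open>The path is assumed in both directions because the states of \<open>x\<close> and
  \<open>y\<close> decide whether the flip is a jump or an unjump, and from which end it is
  made.\<close>

lemma peg_move_flip:
  assumes p: "path3 G x y z" "path3 G z y x"
    and o: "x \<in> S \<longleftrightarrow> z \<notin> S" and d: "sym_diff S T = {x, y, z}"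
  shows "peg_move G S T"
proof -
  have ne: "x \<noteq> y" "y \<noteq> z" "x \<noteq> z"
    using p by (auto simp: path3_def)
  have T: "T = sym_diff S {x, y, z}"
    using d by blast
  consider "x \<in> S" "y \<in> S" "z \<notin> S" | "x \<in> S" "y \<notin> S" "z \<notin> S"
    | "x \<notin> S" "y \<in> S" "z \<in> S" | "x \<notin> S" "y \<notin> S" "z \<in> S"
    using o by blast
  then show ?thesis
  proof cases
    case 1
    then have "peg_jump G S T"
      unfolding peg_jump_def T using p ne by (intro exI[of _ x] exI[of _ y] exI[of _ z]) auto
    then show ?thesis by (simp add: peg_move_def)
  next
    case 2
    then have "peg_unjump G S T"
      unfolding peg_unjump_def T using p ne by (intro exI[of _ z] exI[of _ y] exI[of _ x]) auto
    then show ?thesis by (simp add: peg_move_def)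
  next
    case 3
    then have "peg_jump G S T"
      unfolding peg_jump_def T using p ne by (intro exI[of _ z] exI[of _ y] exI[of _ x]) auto
    then show ?thesis by (simp add: peg_move_def)
  next
    case 4
    then have "peg_unjump G S T"
      unfolding peg_unjump_def T using p ne by (intro exI[of _ x] exI[of _ y] exI[of _ z]) auto
    then show ?thesis by (simp add: peg_move_def)
  qed
qed

text \<open>This carries path solutions into cycles along rotations. Injectivity keeps the three
  vertices distinct and \<open>f z\<close> a hole; an unjump is a jump read backwards.\<close>

lemma peg_move_image:
  fixes G :: "'a pair_pre_digraph" and H :: "'b pair_pre_digraph"
  assumes G: "pair_graph G" and inj: "inj_on f (pverts G)" and S: "S \<subseteq> pverts G"
    and hom: "\<And>x y. x \<rightarrow>\<^bsub>G\<^esub> y \<Longrightarrow> f x \<rightarrow>\<^bsub>H\<^esub> f y"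
    and m: "peg_move G S T"
  shows "peg_move H (f ` S) (f ` T)"
proof -
  have jump: "peg_jump H (f ` A) (f ` B)" if A: "A \<subseteq> pverts G" and j: "peg_jump G A B" for A B
  proof -
    obtain x y z where p: "path3 G x y z"
      and xyz: "x \<in> A" "y \<in> A" "z \<notin> A" "B = (A - {x, y}) \<union> {z}"
      using j unfolding peg_jump_def by blast
    interpret pair_graph G by fact
    have V: "x \<in> pverts G" "y \<in> pverts G" "z \<in> pverts G"
      using p by (auto simp: path3_def dest: in_arcsD1 in_arcsD2)
    have "path3 H (f x) (f y) (f z)"
      using p V inj hom by (auto simp: path3_def inj_on_def)
    moreover have "f z \<notin> f ` A"
      using xyz V A inj by (auto simp: inj_on_def)
    moreover have "f ` B = (f ` A - {f x, f y}) \<union> {f z}"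
      using xyz V A inj by (auto simp: inj_on_def)
    ultimately show ?thesis
      unfolding peg_jump_def using xyz by blast
  qed
  have T: "T \<subseteq> pverts G"
    using peg_move_subset_pverts[OF G S m] .
  show ?thesis
    using m jump[OF S] jump[OF T] by (auto simp: peg_move_def peg_unjump_iff_jump)
qed

lemma peg_reaches_subset_pverts:
  assumes "peg_reaches G S T" "pair_graph G" "S \<subseteq> pverts G"
  shows "T \<subseteq> pverts G"
  using assms by (induction rule: rtranclp_induct) (auto dest: peg_move_subset_pverts)

lemma peg_reaches_image:
  fixes G :: "'a pair_pre_digraph" and H :: "'b pair_pre_digraph"
  assumes r: "peg_reaches G S T"
    and G: "pair_graph G" and inj: "inj_on f (pverts G)" and S: "S \<subseteq> pverts G"
    and hom: "\<And>x y. x \<rightarrow>\<^bsub>G\<^esub> y \<Longrightarrow> f x \<rightarrow>\<^bsub>H\<^esub> f y"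
  shows "peg_reaches H (f ` S) (f ` T)"
  using r
proof (induction rule: rtranclp_induct)
  case (step T U)
  have "T \<subseteq> pverts G"
    using peg_reaches_subset_pverts[OF step.hyps(1) G S] .
  then have "peg_move H (f ` T) (f ` U)"
    using peg_move_image[OF G inj _ hom step.hyps(2)] by blast
  with step.IH show ?case by simp
qed simp

lemma solvableI:
  assumes "h \<in> pverts G" "c \<in> pverts G" "peg_reaches G (pverts G - {h}) {c}"
  shows "solvable G"
  unfolding solvable_def one_hole_def one_peg_def using assms by blast

section \<open>Configurations as words\<close>

text \<open>Illegal and overhanging windows leave the word unchanged, so lists of positions can be
  folded without side conditions.\<close>

fun flip3 :: "nat \<Rightarrow> bool list \<Rightarrow> bool list" where
  "flip3 0 (a # b # c # w) = (if a = c then a # b # c # w else (\<not> a) # (\<not> b) # (\<not> c) # w)"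
| "flip3 (Suc i) (a # w) = a # flip3 i w"
| "flip3 _ w = w"

lemma length_flip3 [simp]: "length (flip3 i w) = length w"
  by (induction i w rule: flip3.induct) auto

lemma flip3_inactive:
  "\<not> (i + 2 < length w \<and> w ! i \<noteq> w ! (i + 2)) \<Longrightarrow> flip3 i w = w"
  by (induction i w rule: flip3.induct) auto

lemma nth_flip3:
  "i + 2 < length w \<Longrightarrow> w ! i \<noteq> w ! (i + 2) \<Longrightarrow> k < length w \<Longrightarrow>
    flip3 i w ! k = (if k \<in> {i, i + 1, i + 2} then \<not> w ! k else w ! k)"
proof (induction i w arbitrary: k rule: flip3.induct)
  case (1 a b c w)
  then show ?case by (auto simp: nth_Cons split: nat.splits)
next
  case (2 i a w)
  then show ?case by (cases k) auto
qed auto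

lemma flip3_append_left: "flip3 (length u + i) (u @ w) = u @ flip3 i w"
  by (induction u) auto

text \<open>A window that sticks out of \<open>w\<close> is idle on \<open>w\<close> but may be
  active on \<open>w @ v\<close>; the first disjunct absorbs this case.\<close>

lemma flip3_append_right: "flip3 i w = w \<or> flip3 i (w @ v) = flip3 i w @ v"
  by (induction i w rule: flip3.induct) auto

definition word_move :: "bool list \<Rightarrow> bool list \<Rightarrow> bool" where
  "word_move w w' \<longleftrightarrow> (\<exists>i. w' = flip3 i w)"

abbreviation word_reaches :: "bool list \<Rightarrow> bool list \<Rightarrow> bool" where
  "word_reaches \<equiv> word_move\<^sup>*\<^sup>*"

lemma word_reaches_fold_flip3: "word_reaches w (fold flip3 is w)"
proof (induction "is" arbitrary: w)
  case (Cons i "is")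
  have "word_move w (flip3 i w)"
    by (auto simp: word_move_def)
  then show ?case
    using Cons[of "flip3 i w"] by (simp add: converse_rtranclp_into_rtranclp)
qed simp

lemma word_reaches_context:
  assumes "word_reaches w w'"
  shows "word_reaches (u @ w @ v) (u @ w' @ v)"
  using assms
proof (induction rule: rtranclp_induct)
  case (step x y)
  then obtain i where y: "y = flip3 i x"
    by (auto simp: word_move_def)
  have "y = x \<or> word_move (u @ x @ v) (u @ y @ v)"
    using flip3_append_right[of i x v] flip3_append_left[of u i "x @ v"]
    unfolding y word_move_def by metis
  with step.IH show ?case
    by (auto intro: rtranclp.rtrancl_into_rtrancl)
qed simp

definition pegs :: "bool list \<Rightarrow> nat set" where
  "pegs w = {i. i < length w \<and> w ! i}"

lemma path3_path_graph:
  "path3 (path_graph n) x y z \<longleftrightarrow>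
    x < n \<and> z < n \<and> (y = x + 1 \<and> z = x + 2 \<or> y = z + 1 \<and> x = z + 2)"
  by (auto simp: path3_def path_graph_def)

lemma length_word_reaches: "word_reaches w w' \<Longrightarrow> length w' = length w"
  by (induction rule: rtranclp_induct) (auto simp: word_move_def)

lemma word_reaches_imp_peg_reaches:
  assumes "word_reaches w w'"
  shows "peg_reaches (path_graph (length w)) (pegs w) (pegs w')"
  using assms
proof (induction rule: rtranclp_induct)
  case (step x y)
  then obtain i where y: "y = flip3 i x"
    by (auto simp: word_move_def)
  have len: "length x = length w"
    using step.hyps(1) by (rule length_word_reaches)
  have "y = x \<or> peg_move (path_graph (length w)) (pegs x) (pegs y)"
  proof (cases "i + 2 < length x \<and> x ! i \<noteq> x ! (i + 2)")
    case True
    have "sym_diff (pegs x) (pegs y) = {i, i + 1, i + 2}"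
      using True unfolding pegs_def y by (auto simp: nth_flip3 split: if_splits)
    then have "peg_move (path_graph (length w)) (pegs x) (pegs y)"
      using True len
      by (intro peg_move_flip[of _ i "i + 1" "i + 2"]) (auto simp: path3_path_graph pegs_def)
    then show ?thesis by simp
  qed (simp add: y flip3_inactive)
  with step.IH show ?case
    by (auto intro: rtranclp.rtrancl_into_rtrancl)
qed simp

text \<open>The reading order \<open>f\<close> is a parameter: \<open>id\<close> on paths, a
  rotation on cycles.\<close>

definition config_word :: "nat \<Rightarrow> (nat \<Rightarrow> 'a) \<Rightarrow> 'a set \<Rightarrow> bool list" where
  "config_word n f S = map (\<lambda>k. f k \<in> S) [0..<n]"

lemma config_word_flip:
  assumes inj: "inj_on f {..<n}" and j: "j + 2 < n"
    and o: "f j \<in> S \<longleftrightarrow> f (j + 2) \<notin> S"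
    and d: "sym_diff S T = {f j, f (j + 1), f (j + 2)}"
  shows "config_word n f T = flip3 j (config_word n f S)"
proof (rule nth_equalityI)
  fix k assume "k < length (config_word n f T)"
  then have k: "k < n"
    by (simp add: config_word_def)
  have "f k \<in> sym_diff S T \<longleftrightarrow> k \<in> {j, j + 1, j + 2}"
    unfolding d using inj j k by (auto simp: inj_on_def)
  then have "f k \<in> T \<longleftrightarrow> (if k \<in> {j, j + 1, j + 2} then f k \<notin> S else f k \<in> S)"
    by auto
  then show "config_word n f T ! k = flip3 j (config_word n f S) ! k"
    using o j k by (subst nth_flip3) (auto simp: config_word_def)
qed (simp add: config_word_def)

definition spot :: "bool \<Rightarrow> nat \<Rightarrow> nat \<Rightarrow> bool list" where
  "spot b n h = replicate h b @ (\<not> b) # replicate (n - Suc h) b"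

lemma nth_spot: "h < n \<Longrightarrow> k < n \<Longrightarrow> spot b n h ! k = (if k = h then \<not> b else b)"
  by (auto simp: spot_def nth_append nth_Cons split: nat.splits)

lemma length_spot: "h < n \<Longrightarrow> length (spot b n h) = n"
  by (simp add: spot_def)

lemma pegs_spot_True: "h < n \<Longrightarrow> pegs (spot True n h) = {..<n} - {h}"
  by (auto simp: pegs_def nth_spot length_spot split: if_splits)

lemma pegs_spot_False: "h < n \<Longrightarrow> pegs (spot False n h) = {h}"
  by (auto simp: pegs_def nth_spot length_spot split: if_splits)

lemma config_word_one_hole:
  assumes "inj_on f {..<n}" "h < n"
  shows "config_word n f (f ` {..<n} - {f h}) = spot True n h"
  using assms
  by (intro nth_equalityI) (auto simp: config_word_def length_spot nth_spot inj_on_def)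

lemma config_word_one_peg:
  assumes "inj_on f {..<n}" "h < n"
  shows "config_word n f {f h} = spot False n h"
  using assms
  by (intro nth_equalityI) (auto simp: config_word_def length_spot nth_spot inj_on_def)

section \<open>Solutions\<close>

text \<open>The explicit flip sequences below were found by breadth-first search.\<close>

lemma word_reaches_ones_zeros:
  assumes "a \<noteq> b"
  shows "word_reaches (replicate 6 True @ a # b # v) (replicate 6 False @ a # b # v)"
proof -
  have "word_reaches (replicate 6 True @ [a, b]) (replicate 6 False @ [a, b])"
  proof (cases a)
    case True
    then show ?thesis
      using assms word_reaches_fold_flip3[of "replicate 6 True @ [a, b]" "[5, 3, 2, 0, 4, 2, 5, 4]"]
      by (simp add: eval_nat_numeral)
  next
    case False
    then show ?thesis
      using assms word_reaches_fold_flip3[of "replicate 6 True @ [a, b]" "[4, 2, 0, 5, 3, 2, 4, 5]"]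
      by (simp add: eval_nat_numeral)
  qed
  from word_reaches_context[OF this, of "[]" v] show ?thesis by simp
qed

text \<open>A block of six ones can thus travel through zeros to the mixed pair that clears
  it.\<close>

lemma word_reaches_ones_commute:
  "word_reaches (replicate 6 True @ replicate m False) (replicate m False @ replicate 6 True)"
proof (induction m)
  case (Suc m)
  have "word_reaches (replicate 6 True @ [False]) (False # replicate 6 True)"
    using word_reaches_fold_flip3[of "replicate 6 True @ [False]" "[4, 3, 1, 0]"]
    by (simp add: eval_nat_numeral)
  from word_reaches_context[OF this, of "[]" "replicate m False"]
  have "word_reaches (replicate 6 True @ replicate (Suc m) False)
          (False # replicate 6 True @ replicate m False)"
    by simp
  also have "word_reaches \<dots> (replicate (Suc m) False @ replicate 6 True)"
    using word_reaches_context[OF Suc, of "[False]" "[]"] by simp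
  finally show ?case .
qed simp

text \<open>The mixed pair \<open>a # b\<close> acts as a catalyst: the blocks next to it are
  cleared first by induction, then the leftmost block moves through the new zeros and is cleared as
  well.\<close>

lemma word_reaches_ones_zeros_multiple:
  assumes "a \<noteq> b"
  shows "word_reaches (replicate (6 * k) True @ a # b # v) (replicate (6 * k) False @ a # b # v)"
proof (induction k)
  case (Suc k)
  have split: "replicate (6 * Suc k) c = replicate 6 c @ replicate (6 * k) c"
    "replicate (6 * Suc k) c = replicate (6 * k) c @ replicate 6 c" for c :: bool
    by (simp_all add: replicate_add[symmetric] add.commute)
  have "word_reaches (replicate 6 True @ replicate (6 * k) True @ a # b # v)
          (replicate 6 True @ replicate (6 * k) False @ a # b # v)"
    using word_reaches_context[OF Suc, of "replicate 6 True" "[]"] by simp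
  also have "word_reaches \<dots> (replicate (6 * k) False @ replicate 6 True @ a # b # v)"
    using word_reaches_context[OF word_reaches_ones_commute, of "[]" "6 * k" "a # b # v"] by simp
  also have "word_reaches \<dots> (replicate (6 * k) False @ replicate 6 False @ a # b # v)"
    using word_reaches_context[OF word_reaches_ones_zeros[OF assms], of "replicate (6 * k) False" v "[]"]
    by simp
  finally show ?case
    unfolding split(1)[of True] split(2)[of False] by simp
qed simp

lemma path_graph_solution_extend:
  assumes "word_reaches (spot True m h) (spot False m c)" "h < m" "c < 2" "2 \<le> m" "n = 6 * k + m"
  shows "peg_reaches (path_graph n) ({..<n} - {6 * k + h}) {6 * k + c}"
proof -
  have c: "c < m"
    using assms(3,4) by simp
  have ext: "spot b n (6 * k + i) = replicate (6 * k) b @ spot b m i" if "i < m" for b i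
    using assms(5) that by (simp add: spot_def replicate_add)
  \<comment> \<open>Since \<open>c < 2\<close>, the remaining peg sits in one of the first two
    places, so the solved suffix starts with the mixed pair that clears the prefix of ones.\<close>
  have "\<exists>a b v. a \<noteq> b \<and> spot False m c = a # b # v"
  proof -
    obtain j where "m = Suc (Suc j)"
      using assms(4) by (metis add_2_eq_Suc le_Suc_ex)
    moreover have "c = 0 \<or> c = 1"
      using assms(3) by auto
    ultimately show ?thesis
      by (auto simp: spot_def)
  qed
  then obtain a b v where ab: "a \<noteq> b" "spot False m c = a # b # v"
    by blast
  have "word_reaches (spot True n (6 * k + h)) (replicate (6 * k) True @ spot False m c)"
    using word_reaches_context[OF assms(1), of "replicate (6 * k) True" "[]"]
    unfolding ext[OF assms(2)] by simp
  also have "word_reaches \<dots> (spot False n (6 * k + c))"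
    using word_reaches_ones_zeros_multiple[OF ab(1), of k v] c ab(2) by (simp add: ext)
  finally have "word_reaches (spot True n (6 * k + h)) (spot False n (6 * k + c))" .
  from word_reaches_imp_peg_reaches[OF this] show ?thesis
    using assms(2,5) c by (simp add: length_spot pegs_spot_True pegs_spot_False)
qed

lemma path_graph_solution:
  fixes n :: nat
  assumes "n \<ge> 3" "2 dvd n \<or> 3 dvd n"
  obtains h c where "h < n" "c < n" "peg_reaches (path_graph n) ({..<n} - {h}) {c}"
proof -
  have r2: "word_reaches (spot True 2 0) (spot False 2 1)"
    by (simp add: spot_def)
  have r3: "word_reaches (spot True 3 0) (spot False 3 0)"
    using word_reaches_fold_flip3[of "spot True 3 0" "[0]"]
    by (simp add: spot_def eval_nat_numeral)
  have r4: "word_reaches (spot True 4 2) (spot False 4 1)"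
    using word_reaches_fold_flip3[of "spot True 4 2" "[0, 1]"]
    by (simp add: spot_def eval_nat_numeral)
  have r6: "word_reaches (spot True 6 1) (spot False 6 1)"
    using word_reaches_fold_flip3[of "spot True 6 1" "[1, 0, 3, 1]"]
    by (simp add: spot_def eval_nat_numeral)
  have "(\<exists>k. n = 6 * k + 2) \<or> (\<exists>k. n = 6 * k + 3) \<or> (\<exists>k. n = 6 * k + 4) \<or> (\<exists>k. n = 6 * k + 6)"
    using assms by presburger
  then consider k where "n = 6 * k + 2" | k where "n = 6 * k + 3" | k where "n = 6 * k + 4"
    | k where "n = 6 * k + 6"
    by blast
  then show thesis
  proof cases
    case 1
    with path_graph_solution_extend[OF r2 _ _ _ 1] show thesis by (intro that) auto
  next
    case 2
    with path_graph_solution_extend[OF r3 _ _ _ 2] show thesis by (intro that) auto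
  next
    case 3
    with path_graph_solution_extend[OF r4 _ _ _ 3] show thesis by (intro that) auto
  next
    case 4
    with path_graph_solution_extend[OF r6 _ _ _ 4] show thesis by (intro that) auto
  qed
qed

section \<open>Rotated path solutions on cycles, and travelling single pegs\<close>

lemma inj_on_rotate: "inj_on (\<lambda>i. (c + i) mod n) {..<n::nat}"
proof (rule inj_onI)
  fix i j assume "i \<in> {..<n}" "j \<in> {..<n}" "(c + i) mod n = (c + j) mod n"
  then show "i = j"
    by (metis cong_add_lcancel_nat cong_def lessThan_iff mod_less)
qed

lemma image_rotate:
  assumes "n > (0::nat)"
  shows "(\<lambda>i. (c + i) mod n) ` {..<n} = {..<n}"
  using assms by (intro endo_inj_surj inj_on_rotate) auto

lemma cycle_graph_rotate:
  assumes "x \<rightarrow>\<^bsub>path_graph m\<^esub> y" "0 < n"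
  shows "((c + x) mod n) \<rightarrow>\<^bsub>cycle_graph n\<^esub> ((c + y) mod n)"
  using assms by (auto simp: path_graph_def cycle_graph_def mod_Suc_eq)

lemma peg_reaches_cycle_graph_rotate:
  assumes "peg_reaches (path_graph m) S T" "S \<subseteq> {..<m}" "m \<le> n" "0 < n"
  shows "peg_reaches (cycle_graph n) ((\<lambda>i. (c + i) mod n) ` S) ((\<lambda>i. (c + i) mod n) ` T)"
proof (rule peg_reaches_image[OF assms(1) pair_graph_path_graph])
  show "inj_on (\<lambda>i. (c + i) mod n) (pverts (path_graph m))"
    using assms(3) by (intro inj_on_subset[OF inj_on_rotate]) (auto simp: path_graph_def)
  show "S \<subseteq> pverts (path_graph m)"
    using assms(2) by (simp add: path_graph_def)
qed (rule cycle_graph_rotate[OF _ assms(4)])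

lemma cycle_graph_solution:
  fixes n :: nat
  assumes "n \<ge> 3" "2 dvd n \<or> 3 dvd n" "h < n"
  obtains c where "c < n" "peg_reaches (cycle_graph n) ({..<n} - {h}) {c}"
proof -
  obtain h' c' where hc: "h' < n" "c' < n" "peg_reaches (path_graph n) ({..<n} - {h'}) {c'}"
    using path_graph_solution assms by blast
  \<comment> \<open>The offset stands for \<open>h - h'\<close> modulo \<open>n\<close>, with the
    truncated subtraction kept harmless by \<open>h' < n\<close>.\<close>
  define f where "f i = (h + (n - h') + i) mod n" for i
  have "f h' = h"
    using hc assms by (simp add: f_def)
  moreover have "inj_on f {..<n}" "f ` {..<n} = {..<n}"
    using assms inj_on_rotate image_rotate by (auto simp: f_def[abs_def])
  ultimately have "f ` ({..<n} - {h'}) = {..<n} - {h}"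
    using hc by (subst inj_on_image_set_diff[of f "{..<n}"]) auto
  moreover have "peg_reaches (cycle_graph n) (f ` ({..<n} - {h'})) (f ` {c'})"
    using peg_reaches_cycle_graph_rotate[OF hc(3), of n "h + (n - h')"] assms
    unfolding f_def[abs_def] by auto
  ultimately have "peg_reaches (cycle_graph n) ({..<n} - {h}) {f c'}"
    by simp
  moreover have "f c' < n"
    using assms by (simp add: f_def)
  ultimately show thesis using that by blast
qed

text \<open>The moves are \<open>1000\<close>, \<open>0110\<close>, \<open>0001\<close>;
  \<open>n >= 4\<close> gives room for four distinct vertices.\<close>

lemma cycle_graph_shift3:
  assumes "n \<ge> 4" "c < n"
  shows "peg_reaches (cycle_graph n) {c} {(c + 3 * k) mod n}"
proof (induction k)
  case (Suc k)
  have "word_reaches (spot False 4 0) (spot False 4 3)"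
    using word_reaches_fold_flip3[of "spot False 4 0" "[0, 1]"]
    by (simp add: spot_def eval_nat_numeral)
  from word_reaches_imp_peg_reaches[OF this]
  have "peg_reaches (path_graph 4) {0} {3}"
    by (simp add: length_spot pegs_spot_False)
  from peg_reaches_cycle_graph_rotate[OF this, of n "c + 3 * k"]
  have "peg_reaches (cycle_graph n) {(c + 3 * k) mod n} {(c + 3 * Suc k) mod n}"
    using assms by (simp add: algebra_simps)
  with Suc show ?case by simp
qed (use assms in simp)

lemma cycle_graph_single_pegs:
  assumes "n \<ge> 4" "\<not> 3 dvd n" "c < n" "v < n"
  shows "peg_reaches (cycle_graph n) {c} {v}"
proof -
  have "coprime 3 n"
    using assms(2) by (simp add: prime_imp_coprime)
  then obtain x where "[3 * x = Suc 0] (mod n)"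
    using cong_solve_coprime_nat by blast
  \<comment> \<open>Here \<open>x\<close> inverts \<open>3\<close> modulo \<open>n\<close>, and
    \<open>v + (n - c)\<close> stands for \<open>v - c\<close>.\<close>
  define k where "k = x * (v + (n - c))"
  have "[3 * x * (v + (n - c)) = Suc 0 * (v + (n - c))] (mod n)"
    using \<open>[3 * x = Suc 0] (mod n)\<close> by (rule cong_scalar_right)
  then have "[c + 3 * k = c + (v + (n - c))] (mod n)"
    by (simp add: k_def cong_add_lcancel_nat mult.assoc)
  also have "c + (v + (n - c)) = v + n"
    using assms(3) by simp
  finally have "(c + 3 * k) mod n = v"
    using assms(4) by (simp add: cong_def)
  with cycle_graph_shift3[OF assms(1,3), of k] show ?thesis by simp
qed

section \<open>The parity invariant\<close>

lemma path3_cycle_graph: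
  assumes "path3 (cycle_graph n) x y z"
  shows "x < n \<and> y = (x + 1) mod n \<and> z = (x + 2) mod n \<or>
    z < n \<and> y = (z + 1) mod n \<and> x = (z + 2) mod n"
proof -
  have V: "x < n" "y < n" "z < n" and "x \<noteq> z"
    and xy: "y = Suc x mod n \<or> x = Suc y mod n" and yz: "z = Suc y mod n \<or> y = Suc z mod n"
    using assms by (auto simp: path3_def cycle_graph_def)
  \<comment> \<open>Injectivity of the successor modulo \<open>n\<close> prevents \<open>y\<close>
    from following both \<open>x\<close> and \<open>z\<close>; \<open>y\<close> cannot precede both
    since they are distinct.\<close>
  have "x = z" if "Suc x mod n = Suc z mod n"
    using inj_onD[OF inj_on_rotate[of 1 n], of x z] V that by simp
  then have "y = Suc x mod n \<and> z = Suc y mod n \<or> y = Suc z mod n \<and> x = Suc y mod n"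
    using xy yz \<open>x \<noteq> z\<close> by metis
  then show ?thesis
    using V by (auto simp: mod_Suc_eq)
qed

lemma even_card_sym_diff:
  assumes "finite A" "finite B" "even (card (sym_diff A B))"
  shows "even (card A) \<longleftrightarrow> even (card B)"
proof -
  have "card (sym_diff A B) = card (A - B) + card (B - A)"
    using assms by (intro card_Un_disjoint) auto
  moreover have "card A = card (A - B) + card (A \<inter> B)"
    using assms by (subst card_Un_disjoint[symmetric]) (auto intro: arg_cong[of _ _ card])
  moreover have "card B = card (B - A) + card (A \<inter> B)"
    using assms by (subst card_Un_disjoint[symmetric]) (auto intro: arg_cong[of _ _ card])
  ultimately show ?thesis
    using assms(3) by auto
qed

text \<open>As \<open>3 dvd n\<close>, residues modulo \<open>3\<close> are consistent around the
  cycle. Three consecutive vertices meet each residue class once, so a move changes exactly two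
  vertices of \<open>Q\<close>.\<close>

lemma peg_reaches_cycle_graph_parity:
  assumes "peg_reaches (cycle_graph n) S T" "S \<subseteq> {..<n}" "n \<ge> 3" "3 dvd n"
  defines "Q \<equiv> {i. i mod 3 \<noteq> 2}"
  shows "even (card (T \<inter> Q)) \<longleftrightarrow> even (card (S \<inter> Q))"
  using assms(1)
proof (induction rule: rtranclp_induct)
  case (step T U)
  have G: "pair_graph (cycle_graph n)"
    using pair_graph_cycle_graph assms(3) .
  have V: "pverts (cycle_graph n) = {..<n}"
    by (simp add: cycle_graph_def)
  have "T \<subseteq> {..<n}"
    using peg_reaches_subset_pverts[OF step.hyps(1) G] assms(2) V by simp
  moreover from this have "U \<subseteq> {..<n}"
    using peg_move_subset_pverts[OF G _ step.hyps(2)] V by simp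
  ultimately have fin: "finite T" "finite U"
    using finite_subset by blast+
  obtain x y z where p: "path3 (cycle_graph n) x y z" and d: "sym_diff T U = {x, y, z}"
    using step.hyps(2) by (rule peg_moveE)
  have m: "(k mod n) mod 3 = k mod 3" for k
    using assms(4) by (rule mod_mod_cancel)
  have "x \<noteq> y" "y \<noteq> z" "x \<noteq> z"
    using p by (auto simp: path3_def)
  moreover have "x \<notin> Q \<and> y \<in> Q \<and> z \<in> Q \<or> x \<in> Q \<and> y \<notin> Q \<and> z \<in> Q \<or> x \<in> Q \<and> y \<in> Q \<and> z \<notin> Q"
  proof -
    have residue: "i \<notin> Q \<and> (i + 1) mod n \<in> Q \<and> (i + 2) mod n \<in> Q \<or>
      i \<in> Q \<and> (i + 1) mod n \<notin> Q \<and> (i + 2) mod n \<in> Q \<or>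
      i \<in> Q \<and> (i + 1) mod n \<in> Q \<and> (i + 2) mod n \<notin> Q" for i
      unfolding Q_def mem_Collect_eq m by presburger
    show ?thesis
      using path3_cycle_graph[OF p] residue[of x] residue[of z] by blast
  qed
  ultimately have "card ({x, y, z} \<inter> Q) = 2"
    by (elim disjE) simp_all
  moreover have "sym_diff (T \<inter> Q) (U \<inter> Q) = {x, y, z} \<inter> Q"
    unfolding d[symmetric] by blast
  ultimately have "even (card (sym_diff (T \<inter> Q) (U \<inter> Q)))"
    by simp
  then have "even (card (T \<inter> Q)) \<longleftrightarrow> even (card (U \<inter> Q))"
    using fin by (intro even_card_sym_diff) auto
  with step.IH show ?case by simp
qed simp

lemma cycle_graph_not_doubly_freely_solvable:
  fixes n :: nat
  assumes "n \<ge> 3" "3 dvd n"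
  shows "\<not> doubly_freely_solvable (cycle_graph n)"
proof
  assume double: "doubly_freely_solvable (cycle_graph n)"
  have "one_hole (cycle_graph n) ({..<n} - {0})"
    unfolding one_hole_def using assms(1) by (intro bexI[of _ 0]) (simp_all add: cycle_graph_def)
  with double have single: "peg_reaches (cycle_graph n) ({..<n} - {0}) {v}" if "v < n" for v
    using that by (simp add: doubly_freely_solvable_def cycle_graph_def)
  have "even (card ({v} \<inter> {i. i mod 3 \<noteq> 2})) \<longleftrightarrow> even (card (({..<n} - {0}) \<inter> {i. i mod 3 \<noteq> 2}))"
    if "v < n" for v
    using peg_reaches_cycle_graph_parity[OF single[OF that] _ assms] by simp
  \<comment> \<open>Vertex \<open>0\<close> lies in \<open>Q\<close> and vertex \<open>2\<close>
    does not, so one start cannot reach both single pegs.\<close>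
  from this[of 0] this[of 2] assms(1)
  show False by simp
qed

section \<open>The matrix invariant\<close>

definition mat2 :: "'a \<Rightarrow> 'a \<Rightarrow> 'a \<Rightarrow> 'a \<Rightarrow> ('a::comm_ring_1)^2^2" where
  "mat2 a b c d = vector [vector [a, b], vector [c, d]]"

lemma mat2_mult:
  "mat2 a b c d ** mat2 a' b' c' d' =
    mat2 (a * a' + b * c') (a * b' + b * d') (c * a' + d * c') (c * b' + d * d')"
  by (simp add: mat2_def matrix_matrix_mult_def vec_eq_iff forall_2 sum_2)

lemma mat2_eq_iff: "mat2 a b c d = mat2 a' b' c' d' \<longleftrightarrow> a = a' \<and> b = b' \<and> c = c' \<and> d = d'"
  by (auto simp: mat2_def vec_eq_iff forall_2)

lemma mat_1_eq_mat2: "mat 1 = mat2 1 0 0 1"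
  by (simp add: mat2_def mat_def vec_eq_iff forall_2)

lemma trace_mat2: "trace (mat2 a b c d) = a + d"
  by (simp add: mat2_def trace_def sum_2)

text \<open>The peg matrix has characteristic polynomial \<open>x^2 - x + 1\<close>, hence cube
  \<open>-1\<close> and order \<open>6\<close>; the hole matrix is unipotent of order
  \<open>3\<close>.\<close>

definition peg_matrix :: "bool \<Rightarrow> 3^2^2" where
  "peg_matrix b = (if b then mat2 0 2 1 1 else mat2 1 1 0 1)"

primrec word_matrix :: "bool list \<Rightarrow> 3^2^2" where
  "word_matrix [] = mat 1"
| "word_matrix (b # w) = peg_matrix b ** word_matrix w"

text \<open>With entries written as \<open>0\<close>, \<open>1\<close>, \<open>2\<close>, an entry
  of a product is at most \<open>2 * 2 + 2 * 2 = 8\<close>, so these rules normalise every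
  result.\<close>

lemma numerals_mod_3:
  "(3 :: 3) = 0" "(4 :: 3) = 1" "(5 :: 3) = 2" "(6 :: 3) = 0" "(7 :: 3) = 1" "(8 :: 3) = 2"
  by simp_all

lemmas matrix_eval = peg_matrix_def mat2_mult mat2_eq_iff mat_1_eq_mat2 trace_mat2 numerals_mod_3

lemma word_matrix_append: "word_matrix (u @ v) = word_matrix u ** word_matrix v"
  by (induction u) (simp_all add: matrix_mul_assoc)

text \<open>With \<open>P\<close> for a peg and \<open>H\<close> for a hole, the cases amount to
  \<open>PPH = HHP\<close> and \<open>PHH = HPP\<close>.\<close>

lemma peg_matrix_flip:
  assumes "a \<noteq> c"
  shows "peg_matrix a ** (peg_matrix b ** peg_matrix c) =
    peg_matrix (\<not> a) ** (peg_matrix (\<not> b) ** peg_matrix (\<not> c))"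
  using assms by (cases a; cases b; cases c) (simp_all add: matrix_eval)

lemma word_matrix_flip3 [simp]: "word_matrix (flip3 i w) = word_matrix w"
proof (induction i w rule: flip3.induct)
  case (1 a b c w)
  then show ?case
    using peg_matrix_flip[of a c b] by (simp add: matrix_mul_assoc)
qed auto

lemma word_matrix_replicate_mod:
  assumes "word_matrix (replicate p b) = mat 1"
  shows "word_matrix (replicate k b) = word_matrix (replicate (k mod p) b)"
proof -
  have "word_matrix (replicate (p * q + r) b) = word_matrix (replicate r b)" for q r
    by (induction q) (simp_all add: replicate_add word_matrix_append assms)
  from this[of "k div p" "k mod p"] show ?thesis by simp
qed

lemma word_matrix_ones: "word_matrix (replicate k True) = word_matrix (replicate (k mod 6) True)"
  by (rule word_matrix_replicate_mod) (simp add: numeral_eq_Suc matrix_eval)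

lemma word_matrix_zeros: "word_matrix (replicate k False) = word_matrix (replicate (k mod 3) False)"
  by (rule word_matrix_replicate_mod) (simp add: numeral_eq_Suc matrix_eval)

section \<open>The matrix product on paths\<close>

lemma peg_reaches_path_graph_word_matrix:
  assumes "peg_reaches (path_graph n) S T"
  shows "word_matrix (config_word n id T) = word_matrix (config_word n id S)"
  using assms
proof (induction rule: rtranclp_induct)
  case (step T U)
  from step.hyps(2) obtain x y z where "path3 (path_graph n) x y z"
    and o: "x \<in> T \<longleftrightarrow> z \<notin> T" and d: "sym_diff T U = {x, y, z}"
    by (rule peg_moveE)
  then consider "z < n" "y = x + 1" "z = x + 2" | "x < n" "y = z + 1" "x = z + 2"
    by (auto simp: path3_path_graph)
  then obtain j where "config_word n id U = flip3 j (config_word n id T)"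
  proof cases
    case 1
    have "config_word n id U = flip3 x (config_word n id T)"
      by (rule config_word_flip) (use 1 o d in simp_all)
    then show thesis by (rule that)
  next
    case 2
    have "config_word n id U = flip3 z (config_word n id T)"
      by (rule config_word_flip) (use 2 o d in \<open>simp_all add: insert_commute\<close>)
    then show thesis by (rule that)
  qed
  with step.IH show ?case by (simp only: word_matrix_flip3)
qed simp

lemma not_freely_solvable_path_graph:
  assumes "h < n"
    and "\<And>c. c < n \<Longrightarrow> word_matrix (spot True n h) \<noteq> word_matrix (spot False n c)"
  shows "\<not> freely_solvable (path_graph n)"
proof
  assume "freely_solvable (path_graph n)"
  moreover have "one_hole (path_graph n) ({..<n} - {h})"
    using assms(1) by (auto simp: one_hole_def path_graph_def)
  ultimately obtain c where c: "c < n" "peg_reaches (path_graph n) ({..<n} - {h}) {c}"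
    unfolding freely_solvable_def one_peg_def by (auto simp: path_graph_def)
  from peg_reaches_path_graph_word_matrix[OF c(2)] show False
    using config_word_one_hole[of id n h] config_word_one_peg[of id n c] assms(1) assms(2)[OF c(1)] c(1)
    by simp
qed

lemma word_matrix_spot:
  "word_matrix (spot True n h) =
    word_matrix (replicate (h mod 6) True @ False # replicate ((n - Suc h) mod 6) True)"
  "word_matrix (spot False n h) =
    word_matrix (replicate (h mod 3) False @ True # replicate ((n - Suc h) mod 3) False)"
  by (simp_all add: spot_def word_matrix_append flip: word_matrix_ones word_matrix_zeros)

text \<open>The residues \<open>i\<close> of \<open>c\<close> and \<open>j\<close> of
  \<open>n - Suc c\<close> satisfy \<open>i + j + 1 < 2 * m\<close>, so at most one wraparound
  occurs. This turns claims about all lengths into finitely many residue cases.\<close>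

lemma mod_diff_Suc:
  fixes c n m :: nat
  assumes "c < n" "0 < m"
  shows "(n - Suc c) mod m = (n mod m + (m - 1) - c mod m) mod m"
proof -
  define i j where "i = c mod m" and "j = (n - Suc c) mod m"
  have ij: "i < m" "j < m"
    using assms(2) by (simp_all add: i_def j_def)
  have "(i + j + 1) mod m = (c + (n - Suc c) + 1) mod m"
    unfolding i_def j_def by (metis mod_add_eq mod_add_left_eq)
  then have n: "n mod m = (i + j + 1) mod m"
    using assms(1) by simp
  have "j = (n mod m + (m - 1) - i) mod m"
  proof (cases "i + j + 1 < m")
    case True
    then have "n mod m + (m - 1) - i = j + m"
      using n by simp
    then show ?thesis using ij by simp
  next
    case False
    then have "n mod m = i + j + 1 - m"
      using n ij by (simp add: mod_if)
    then have "n mod m + (m - 1) - i = j"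
      using False ij by linarith
    then show ?thesis using ij by simp
  qed
  then show ?thesis by (simp add: i_def j_def)
qed

text \<open>The final peg matters only through its position modulo \<open>3\<close>, which leaves
  three matrix inequalities.\<close>

lemma not_freely_solvable_path_graph_residues:
  assumes h: "h < n" and residues: "h mod 6 = a" "(n - Suc h) mod 6 = b" "n mod 3 = r"
    and neq: "\<forall>i\<in>{0, 1, 2}. word_matrix (replicate a True @ False # replicate b True) \<noteq>
      word_matrix (replicate i False @ True # replicate ((r + 2 - i) mod 3) False)"
  shows "\<not> freely_solvable (path_graph n)"
proof (rule not_freely_solvable_path_graph[OF h])
  fix c assume "c < n"
  then have "(n - Suc c) mod 3 = (r + 2 - c mod 3) mod 3"
    using mod_diff_Suc[of c n 3] residues(3) by simp
  moreover have "c mod 3 \<in> {0, 1, 2}"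
    by auto
  ultimately show "word_matrix (spot True n h) \<noteq> word_matrix (spot False n c)"
    unfolding word_matrix_spot residues using neq by metis
qed

lemma path_graph_not_freely_solvable:
  fixes n :: nat
  assumes "n \<ge> 3" "2 dvd n \<or> 3 dvd n"
  shows "\<not> freely_solvable (path_graph n)"
proof -
  \<comment> \<open>For residues \<open>2\<close> and \<open>3\<close> the hole \<open>0\<close>
    would not do: its matrix equals that of the hole \<open>6 * k\<close>, which is solvable. For
    residue \<open>2\<close> the mirror image rules out \<open>1\<close> too.\<close>
  define h :: nat where "h = (if n mod 6 = 3 then 1 else if n mod 6 = 2 then 2 else 0)"
  have h: "h < n"
    using assms(1) by (simp add: h_def)
  have "n mod 6 = 2 \<or> n mod 6 = 3 \<or> n mod 6 = 4 \<or> n mod 6 = 0"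
    using assms(2) by presburger
  then consider "n mod 6 = 2" "h = 2" | "n mod 6 = 3" "h = 1" | "n mod 6 = 4" "h = 0"
    | "n mod 6 = 0" "h = 0"
    by (auto simp: h_def)
  then show ?thesis
  proof cases
    case 1
    then have "h mod 6 = 2"
      by simp
    moreover from this have "(n - Suc h) mod 6 = 5"
      using mod_diff_Suc[OF h, of 6] 1(1) by simp
    moreover have "n mod 3 = 2"
      using mod_mod_cancel[of 3 6 n] 1(1) by simp
    ultimately show ?thesis
      \<comment> \<open>The residues are simplified first, then \<open>replicate\<close> is
        unrolled, and last the products are evaluated over \<open>Z/3\<close>.\<close>
      by (rule not_freely_solvable_path_graph_residues[OF h])
        (simp, simp add: numeral_eq_Suc, simp add: matrix_eval)
  next
    case 2
    then have "h mod 6 = 1"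
      by simp
    moreover from this have "(n - Suc h) mod 6 = 1"
      using mod_diff_Suc[OF h, of 6] 2(1) by simp
    moreover have "n mod 3 = 0"
      using mod_mod_cancel[of 3 6 n] 2(1) by simp
    ultimately show ?thesis
      by (rule not_freely_solvable_path_graph_residues[OF h])
        (simp, simp add: numeral_eq_Suc, simp add: matrix_eval)
  next
    case 3
    then have "h mod 6 = 0"
      by simp
    moreover from this have "(n - Suc h) mod 6 = 3"
      using mod_diff_Suc[OF h, of 6] 3(1) by simp
    moreover have "n mod 3 = 1"
      using mod_mod_cancel[of 3 6 n] 3(1) by simp
    ultimately show ?thesis
      by (rule not_freely_solvable_path_graph_residues[OF h])
        (simp, simp add: numeral_eq_Suc, simp add: matrix_eval)
  next
    case 4
    then have "h mod 6 = 0"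
      by simp
    moreover from this have "(n - Suc h) mod 6 = 5"
      using mod_diff_Suc[OF h, of 6] 4(1) by simp
    moreover have "n mod 3 = 0"
      using mod_mod_cancel[of 3 6 n] 4(1) by simp
    ultimately show ?thesis
      by (rule not_freely_solvable_path_graph_residues[OF h])
        (simp, simp add: numeral_eq_Suc, simp add: matrix_eval)
  qed
qed

section \<open>The trace on cycles\<close>

lemma trace_word_matrix_rotate1: "trace (word_matrix (rotate1 w)) = trace (word_matrix w)"
proof (cases w)
  case (Cons b v)
  then show ?thesis
    using trace_mul_sym[of "word_matrix v" "peg_matrix b"] by (simp add: word_matrix_append)
qed simp

lemma config_word_rotate_Suc:
  "config_word n (\<lambda>k. (Suc i + k) mod n) S = rotate1 (config_word n (\<lambda>k. (i + k) mod n) S)"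
proof (rule nth_equalityI)
  fix k assume "k < length (config_word n (\<lambda>k. (Suc i + k) mod n) S)"
  then have k: "k < n"
    by (simp add: config_word_def)
  then have "(i + Suc k mod n) mod n = (Suc i + k) mod n"
    by (simp add: mod_add_right_eq)
  moreover have "Suc k mod n < n"
    using k by simp
  ultimately show "config_word n (\<lambda>k. (Suc i + k) mod n) S ! k =
      rotate1 (config_word n (\<lambda>k. (i + k) mod n) S) ! k"
    using k by (simp add: config_word_def nth_rotate1)
qed (simp add: config_word_def)

text \<open>Writing \<open>0 + k\<close> makes this literally the instance \<open>i = 0\<close> of
  the reading orders \<open>(i + k) mod n\<close>.\<close>

definition cycle_trace :: "nat \<Rightarrow> nat set \<Rightarrow> 3" where
  "cycle_trace n S = trace (word_matrix (config_word n (\<lambda>k. (0 + k) mod n) S))"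

text \<open>Moving the starting vertex rotates the word, which the trace does not see.\<close>

lemma cycle_trace_start: "cycle_trace n S = trace (word_matrix (config_word n (\<lambda>k. (i + k) mod n) S))"
proof (induction i)
  case (Suc i)
  then show ?case
    by (simp only: config_word_rotate_Suc trace_word_matrix_rotate1)
qed (simp only: cycle_trace_def)

lemma peg_reaches_cycle_graph_cycle_trace:
  assumes "peg_reaches (cycle_graph n) S T" "n \<ge> 3"
  shows "cycle_trace n T = cycle_trace n S"
  using assms(1)
proof (induction rule: rtranclp_induct)
  case (step T U)
  from step.hyps(2) obtain x y z where "path3 (cycle_graph n) x y z"
    and o: "x \<in> T \<longleftrightarrow> z \<notin> T" and d: "sym_diff T U = {x, y, z}"
    by (rule peg_moveE)
  then consider "x < n" "y = (x + 1) mod n" "z = (x + 2) mod n"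
    | "z < n" "y = (z + 1) mod n" "x = (z + 2) mod n"
    using path3_cycle_graph by blast
  \<comment> \<open>Reading from the first vertex of the triple puts the move at window
    \<open>0\<close>, away from the seam of the word.\<close>
  then obtain j where
    "config_word n (\<lambda>k. (j + k) mod n) U = flip3 0 (config_word n (\<lambda>k. (j + k) mod n) T)"
  proof cases
    case 1
    have "config_word n (\<lambda>k. (x + k) mod n) U = flip3 0 (config_word n (\<lambda>k. (x + k) mod n) T)"
      by (rule config_word_flip[OF inj_on_rotate])
        (use 1 o d assms(2) in \<open>simp_all add: insert_commute\<close>)
    then show thesis by (rule that)
  next
    case 2
    have "config_word n (\<lambda>k. (z + k) mod n) U = flip3 0 (config_word n (\<lambda>k. (z + k) mod n) T)"
      by (rule config_word_flip[OF inj_on_rotate])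
        (use 2 o d assms(2) in \<open>simp_all add: insert_commute\<close>)
    then show thesis by (rule that)
  qed
  then have "cycle_trace n U = cycle_trace n T"
    by (simp add: cycle_trace_start[of n _ j])
  with step.IH show ?case by simp
qed simp

text \<open>Reading starts at the hole itself, so all holes give the same word.\<close>

lemma cycle_trace_one_hole:
  assumes "h < n"
  shows "cycle_trace n ({..<n} - {h}) = trace (word_matrix (spot True n 0))"
proof -
  have "0 < n"
    using assms by simp
  from config_word_one_hole[OF inj_on_rotate[of h n] this]
  have "config_word n (\<lambda>k. (h + k) mod n) ({..<n} - {(h + 0) mod n}) = spot True n 0"
    unfolding image_rotate[OF \<open>0 < n\<close>] .
  moreover have "(h + 0) mod n = h"
    using assms by simp
  ultimately show ?thesis
    by (simp only: cycle_trace_start[of n _ h])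
qed

lemma cycle_trace_one_peg:
  assumes "c < n"
  shows "cycle_trace n {c} = trace (word_matrix (spot False n 0))"
proof -
  have "0 < n"
    using assms by simp
  from config_word_one_peg[OF inj_on_rotate[of c n] this]
  have "config_word n (\<lambda>k. (c + k) mod n) {(c + 0) mod n} = spot False n 0" .
  moreover have "(c + 0) mod n = c"
    using assms by simp
  ultimately show ?thesis
    by (simp only: cycle_trace_start[of n _ c])
qed

lemma cycle_graph_not_solvable:
  fixes n :: nat
  assumes "n \<ge> 3" "\<not> 2 dvd n" "\<not> 3 dvd n"
  shows "\<not> solvable (cycle_graph n)"
proof
  assume "solvable (cycle_graph n)"
  then obtain h c where hc: "h < n" "c < n" "peg_reaches (cycle_graph n) ({..<n} - {h}) {c}"
    by (auto simp: solvable_def one_hole_def one_peg_def cycle_graph_def)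
  from peg_reaches_cycle_graph_cycle_trace[OF hc(3) assms(1)]
  have "trace (word_matrix (spot False n 0)) = trace (word_matrix (spot True n 0))"
    using hc by (simp add: cycle_trace_one_hole cycle_trace_one_peg)
  moreover
  have "(n - Suc 0) mod 6 = 0 \<or> (n - Suc 0) mod 6 = 4"
  proof -
    have "n mod 6 = 1 \<or> n mod 6 = 5"
      using assms(2,3) by presburger
    then show ?thesis
      using mod_diff_Suc[of 0 n 6] assms(1) by auto
  qed
  then consider "(n - Suc 0) mod 6 = 0" "(n - Suc 0) mod 3 = 0"
    | "(n - Suc 0) mod 6 = 4" "(n - Suc 0) mod 3 = 1"
    using mod_mod_cancel[of 3 6 "n - Suc 0"] by auto
  \<comment> \<open>The traces for a single peg and a single hole are \<open>1\<close> and
    \<open>2\<close> in the first case, \<open>2\<close> and \<open>1\<close> in the second.\<close>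
  then have "trace (word_matrix (spot False n 0)) \<noteq> trace (word_matrix (spot True n 0))"
  proof cases
    case 1
    show ?thesis
      unfolding word_matrix_spot 1 by (simp, simp add: matrix_eval)
  next
    case 2
    show ?thesis
      unfolding word_matrix_spot 2 by (simp, simp add: numeral_eq_Suc, simp add: matrix_eval)
  qed
  ultimately show False by simp
qed

text \<open>The path is a subgraph of the cycle on the same vertices, so unsolvability of the cycle
  passes to the path.\<close>

lemma solvable_path_graph_imp_cycle_graph:
  fixes n :: nat
  assumes "solvable (path_graph n)"
  shows "solvable (cycle_graph n)"
proof -
  obtain h c where hc: "h < n" "c < n" "peg_reaches (path_graph n) ({..<n} - {h}) {c}"
    using assms by (auto simp: solvable_def one_hole_def one_peg_def path_graph_def)
  have "(\<lambda>i. (0 + i) mod n) ` ({..<n} - {h}) = {..<n} - {h}"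
    by (force simp: image_iff)
  with peg_reaches_cycle_graph_rotate[OF hc(3), of n 0] hc
  have "peg_reaches (cycle_graph n) ({..<n} - {h}) {c}"
    by simp
  with hc(1,2) show ?thesis
    by (intro solvableI[of h _ c]) (simp_all add: cycle_graph_def)
qed

theorem theorem3:
  fixes n :: nat
  assumes "n \<ge> 3"
  shows
    "(\<not> 2 dvd n \<and> \<not> 3 dvd n \<longrightarrow>
        \<not> solvable (path_graph n) \<and> \<not> solvable (cycle_graph n)) \<and>
     (3 dvd n \<longrightarrow>
        (solvable (path_graph n) \<and> \<not> freely_solvable (path_graph n)) \<and>
        (freely_solvable (cycle_graph n) \<and> \<not> doubly_freely_solvable (cycle_graph n))) \<and>
     (\<not> 3 dvd n \<and> 2 dvd n \<longrightarrow>
        (solvable (path_graph n) \<and> \<not> freely_solvable (path_graph n)) \<and>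
        doubly_freely_solvable (cycle_graph n))"
proof -
  have path: "solvable (path_graph n) \<and> \<not> freely_solvable (path_graph n)" if div: "2 dvd n \<or> 3 dvd n"
  proof -
    obtain h c where "h < n" "c < n" "peg_reaches (path_graph n) ({..<n} - {h}) {c}"
      by (rule path_graph_solution[OF assms div])
    then have "solvable (path_graph n)"
      by (intro solvableI[of h _ c]) (simp_all add: path_graph_def)
    with path_graph_not_freely_solvable[OF assms div] show ?thesis by simp
  qed
  have free: "freely_solvable (cycle_graph n)" if three: "3 dvd n"
    unfolding freely_solvable_def
  proof (intro allI impI)
    fix S assume "one_hole (cycle_graph n) S"
    then obtain h where h: "h < n" "S = {..<n} - {h}"
      by (auto simp: one_hole_def cycle_graph_def)
    obtain c where "c < n" "peg_reaches (cycle_graph n) ({..<n} - {h}) {c}"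
      by (rule cycle_graph_solution[OF assms disjI2[OF three] h(1)])
    with h(2) have "one_peg (cycle_graph n) {c} \<and> peg_reaches (cycle_graph n) S {c}"
      by (simp add: one_peg_def cycle_graph_def)
    then show "\<exists>T. one_peg (cycle_graph n) T \<and> peg_reaches (cycle_graph n) S T" ..
  qed
  have double: "doubly_freely_solvable (cycle_graph n)" if three: "\<not> 3 dvd n" and two: "2 dvd n"
    unfolding doubly_freely_solvable_def
  proof (intro allI impI ballI)
    fix S v assume "one_hole (cycle_graph n) S" "v \<in> pverts (cycle_graph n)"
    then obtain h where h: "h < n" "S = {..<n} - {h}" and v: "v < n"
      by (auto simp: one_hole_def cycle_graph_def)
    obtain c where c: "c < n" "peg_reaches (cycle_graph n) ({..<n} - {h}) {c}"
      by (rule cycle_graph_solution[OF assms disjI1[OF two] h(1)])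
    \<comment> \<open>Moving the remaining peg from \<open>c\<close> to \<open>v\<close> in steps of
      three needs at least four vertices.\<close>
    have "n \<noteq> 3"
      using three by auto
    then have "n \<ge> 4"
      using assms by simp
    with c(1) v three have "peg_reaches (cycle_graph n) {c} {v}"
      by (intro cycle_graph_single_pegs)
    with c(2) show "peg_reaches (cycle_graph n) S {v}"
      unfolding h(2) by simp
  qed
  have unsolvable: "\<not> solvable (path_graph n) \<and> \<not> solvable (cycle_graph n)"
    if "\<not> 2 dvd n" "\<not> 3 dvd n"
    using cycle_graph_not_solvable[OF assms that] solvable_path_graph_imp_cycle_graph by blast
  show ?thesis
    by (intro conjI impI) (simp_all add: path free double unsolvable cycle_graph_not_doubly_freely_solvable[OF assms])
qed

end
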